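(* Every block graph $G$ is hangable; that is, if $G$ is a connected graph in which every block is a complete graph, then $P_G(v)\subseteq P(G)$ for every vertex $v$ of $G$.
   Context: All graphs are finite, simple, undirected, with nonempty vertex set. For a connected graph $G=(V_G,E_G)$, $d_G(u,v)$ is the length of a shortest $u$--$v$ path. The eccentricity of $v$ is $e_G(v)=\max\{d_G(v,u): u\in V_G\}$ and the diameter is $d(G)=\max\{e_G(v): v\in V_G\}$. The periphery of a vertex $v$ is $P_G(v)=\{u\in V_G: d_G(v,u)=e_G(v)\}$; the periphery of $G$ is $P(G)=\{v\in V_G: e_G(v)=d(G)\}$. A connected graph $G$ is hangable if $P_G(v)\subseteq P(G)$ for every $v\in V_G$. A block graph is a connected graph in which every block (maximal 2-connected subgraph, where as usual a bridge together with its end vertices also counts as a block $K_2$) is a complete graph. *)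

theory Defs
  imports "Graph_Theory.Graph_Theory"
begin

text \<open>
  A finite simple undirected graph is an instance of the locale \<open>graph\<close>: a finite
  loop-free digraph without parallel arcs whose arc relation is symmetric, an undirected edge
  being a pair of opposite arcs. The library's \<open>connected\<close> includes nonemptiness of the vertex set.
\<close>

definition graph_dist :: "('a, 'b) pre_digraph \<Rightarrow> 'a \<Rightarrow> 'a \<Rightarrow> nat" where
  "graph_dist G u v = (LEAST n. \<exists>p. pre_digraph.apath G u p v \<and> length p = n)"

definition eccentricity :: "('a, 'b) pre_digraph \<Rightarrow> 'a \<Rightarrow> nat" where
  "eccentricity G v = Max (graph_dist G v ` verts G)"

definition graph_diameter :: "('a, 'b) pre_digraph \<Rightarrow> nat" where
  "graph_diameter G = Max (eccentricity G ` verts G)"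

definition vertex_periphery :: "('a, 'b) pre_digraph \<Rightarrow> 'a \<Rightarrow> 'a set" where
  "vertex_periphery G v = {u \<in> verts G. graph_dist G v u = eccentricity G v}"

definition graph_periphery :: "('a, 'b) pre_digraph \<Rightarrow> 'a set" where
  "graph_periphery G = {v \<in> verts G. eccentricity G v = graph_diameter G}"

definition hangable :: "('a, 'b) pre_digraph \<Rightarrow> bool" where
  "hangable G \<longleftrightarrow> graph G \<and> connected G \<and>
    (\<forall>v \<in> verts G. vertex_periphery G v \<subseteq> graph_periphery G)"

definition two_connected :: "('a, 'b) pre_digraph \<Rightarrow> bool" where
  "two_connected H \<longleftrightarrow> graph H \<and> card (verts H) \<ge> 3 \<and> connected H \<and>
    (\<forall>v \<in> verts H. connected (pre_digraph.del_vert H v))"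

text \<open>Deleting an undirected edge means deleting both of its arcs.\<close>

definition del_edge :: "('a, 'b) pre_digraph \<Rightarrow> 'a \<Rightarrow> 'a \<Rightarrow> ('a, 'b) pre_digraph" where
  "del_edge G u v = G \<lparr> arcs := {e \<in> arcs G. {tail G e, head G e} \<noteq> {u, v}} \<rparr>"

definition bridge :: "('a, 'b) pre_digraph \<Rightarrow> 'a \<Rightarrow> 'a \<Rightarrow> bool" where
  "bridge G u v \<longleftrightarrow> u \<rightarrow>\<^bsub>G\<^esub> v \<and> \<not> u \<rightarrow>\<^sup>*\<^bsub>del_edge G u v\<^esub> v"

text \<open>
  Maximality ranges over all subgraphs of \<open>G\<close>, not only induced ones. The one-vertex graph
  has no block, so it is a block graph.
\<close>

definition graph_block :: "('a, 'b) pre_digraph \<Rightarrow> ('a, 'b) pre_digraph \<Rightarrow> bool" where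
  "graph_block G H \<longleftrightarrow> pre_digraph.max_subgraph G two_connected H \<or>
    (\<exists>u v. bridge G u v \<and> H = G \<restriction> {u, v})"

definition block_graph :: "('a, 'b) pre_digraph \<Rightarrow> bool" where
  "block_graph G \<longleftrightarrow> graph G \<and> connected G \<and>
    (\<forall>H. graph_block G H \<longrightarrow> K\<^bsub>card (verts H)\<^esub> H)"

text \<open>
  The library's weighted distance \<open>\<mu>\<close> is extended-real valued and an infimum over walks; with
  unit weights it agrees with \<open>graph_dist\<close>.
\<close>

lemma (in wf_digraph) \<mu>_unit_eq_graph_dist:
  assumes "u \<rightarrow>\<^sup>* v"
  shows "\<mu> (\<lambda>_. 1) u v = ereal (real (graph_dist G u v))"
proof -
  have cost: "awalk_cost (\<lambda>_. 1) p = real (length p)" for p :: "'b list"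
    by (induct p) auto
  from assms obtain p where p: "apath u p v"
    using reachable_apath by blast
  then have ex: "\<exists>n p. apath u p v \<and> length p = n" by blast
  obtain q where q: "apath u q v" "length q = graph_dist G u v"
    using LeastI_ex[OF ex] unfolding graph_dist_def by blast
  have le: "graph_dist G u v \<le> length r" if "awalk u r v" for r
  proof -
    obtain r' where r': "r' = awalk_to_apath r" by simp
    have "apath u r' v" using apath_awalk_to_apath[OF that] r' by simp
    then have "graph_dist G u v \<le> length r'"
      unfolding graph_dist_def by (blast intro: Least_le)
    also have "length r' \<le> length r"
      using that unfolding r'
    proof (induct rule: awalk_to_apath_induct)
      case (path p)
      then show ?case by (auto simp: awalk_to_apath.simps)
    next
      case (decomp p q r s)
      then have "length q + length s \<le> length p"
        by (auto elim!: awalk_cyc_decompE)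
      with decomp show ?case
        using step_awalk_to_apath[of u p v q r s] by simp
    qed
    finally show ?thesis .
  qed
  show ?thesis
    unfolding \<mu>_def
  proof (rule INF_eqI)
    fix r assume "r \<in> {p. awalk u p v}"
    then show "ereal (real (graph_dist G u v)) \<le> ereal (awalk_cost (\<lambda>_. 1) r)"
      using le by (simp add: cost)
  next
    fix y assume "\<And>r. r \<in> {p. awalk u p v} \<Longrightarrow> y \<le> ereal (awalk_cost (\<lambda>_. 1) r)"
    from this[of q] q show "y \<le> ereal (real (graph_dist G u v))"
      by (simp add: cost awalkI_apath)
  qed
qed

end

theory Submission
  imports Defs
begin

text \<open>
  Two neighbours of a vertex \<open>w\<close> that are still joined in \<open>G - w\<close> lie with \<open>w\<close> on a cycle, which is
  2-connected and hence contained in a complete block. So in a block graph every inner vertex of a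
  geodesic separates its ends, and consequently a vertex \<open>w\<close> between \<open>u\<close> and \<open>v\<close> lies, for any \<open>x\<close>,
  between \<open>u\<close> and \<open>x\<close> or between \<open>v\<close> and \<open>x\<close>. This yields the four-point condition, that
  \<open>d(u,v) + d(x,y)\<close> is at most the maximum of \<open>d(u,x) + d(v,y)\<close> and \<open>d(u,y) + d(v,x)\<close>. If \<open>u\<close> is
  farthest from \<open>v\<close> and \<open>x, y\<close> realise the diameter, it forces \<open>d(x,y) \<le> d(u,y)\<close> or
  \<open>d(x,y) \<le> d(u,x)\<close>, so \<open>u\<close> is peripheral.
\<close>

section \<open>Distances\<close>

context wf_digraph
begin

text \<open>The minimum in \<open>graph_dist\<close> ranges over paths only; the unit-weight
  \<open>\<mu>\<close>, an infimum over all walks, carries the bound over to walks.\<close>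

lemma graph_dist_le_awalk:
  assumes "awalk u p v"
  shows "graph_dist G u v \<le> length p"
proof -
  have "awalk_cost (\<lambda>_. 1) q = real (length q)" for q :: "'b list"
    by (induct q) auto
  then show ?thesis
    using min_cost_le_walk_cost[OF assms, of "\<lambda>_. 1"] \<mu>_unit_eq_graph_dist[of u v]
      reachable_awalkI[OF assms] by simp
qed

lemma graph_dist_awalkE:
  assumes "u \<rightarrow>\<^sup>* v"
  obtains p where "awalk u p v" "length p = graph_dist G u v"
proof -
  have "\<exists>n p. apath u p v \<and> length p = n"
    using assms reachable_apath by blast
  then have "\<exists>p. apath u p v \<and> length p = graph_dist G u v"
    unfolding graph_dist_def by (rule LeastI_ex)
  then show thesis using that awalkI_apath by blast
qed

lemma graph_dist_self [simp]: "u \<in> verts G \<Longrightarrow> graph_dist G u u = 0"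
  using graph_dist_le_awalk[of u "[]" u] by (simp add: awalk_Nil_iff)

lemma graph_dist_eq_0D: "u \<rightarrow>\<^sup>* v \<Longrightarrow> graph_dist G u v = 0 \<Longrightarrow> u = v"
  by (metis graph_dist_awalkE awalk_Nil_iff length_0_conv)

lemma graph_dist_adj_le:
  assumes "u \<rightarrow>\<^bsub>G\<^esub> v"
  shows "graph_dist G u v \<le> 1"
proof -
  from assms obtain e where "e \<in> arcs G" "tail G e = u" "head G e = v" ..
  then show ?thesis
    using graph_dist_le_awalk[of u "[e]" v] arc_implies_awalk[of e] by simp
qed

lemma graph_dist_triangle:
  assumes "u \<rightarrow>\<^sup>* v" "v \<rightarrow>\<^sup>* w"
  shows "graph_dist G u w \<le> graph_dist G u v + graph_dist G v w"
proof -
  obtain p q where "awalk u p v" "length p = graph_dist G u v"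
    "awalk v q w" "length q = graph_dist G v w"
    using assms by (meson graph_dist_awalkE)
  then show ?thesis
    using graph_dist_le_awalk[of u "p @ q" w] awalk_appendI by fastforce
qed

text \<open>Take \<open>y\<close> to be the second vertex of a shortest walk: the rest of the walk
  bounds \<open>graph_dist G y v\<close> above, the triangle inequality bounds it below. This is the
  step of every induction along a geodesic below.\<close>

lemma graph_dist_stepE:
  assumes "u \<rightarrow>\<^sup>* v" "u \<noteq> v"
  obtains y where "u \<rightarrow>\<^bsub>G\<^esub> y" "Suc (graph_dist G y v) = graph_dist G u v"
proof -
  obtain p where p: "awalk u p v" "length p = graph_dist G u v"
    using assms(1) by (rule graph_dist_awalkE)
  with assms(2) obtain e q where [simp]: "p = e # q"
    by (cases p) (auto simp: awalk_Nil_iff)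
  let ?y = "head G e"
  have q: "awalk ?y q v" and uy: "u \<rightarrow>\<^bsub>G\<^esub> ?y"
    using p(1) by (auto simp: awalk_Cons_iff in_arcs_imp_in_arcs_ends)
  have "graph_dist G u v \<le> graph_dist G u ?y + graph_dist G ?y v"
    using uy q by (intro graph_dist_triangle) (auto intro: reachable_awalkI)
  with graph_dist_adj_le[OF uy] graph_dist_le_awalk[OF q] p(2)
  have "Suc (graph_dist G ?y v) = graph_dist G u v" by simp
  with uy show thesis by (rule that)
qed

end

lemma (in sym_digraph) graph_dist_sym:
  assumes "u \<rightarrow>\<^sup>* v"
  shows "graph_dist G u v = graph_dist G v u"
proof -
  \<comment> \<open>One inequality suffices, since the other follows by swapping the ends. The
    induction peels off the first arc of a geodesic and traverses it backwards.\<close>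
  have "graph_dist G y x \<le> n" if "x \<rightarrow>\<^sup>* y" "graph_dist G x y = n" for x y n
    using that
  proof (induct n arbitrary: x)
    case 0
    then show ?case using graph_dist_eq_0D reachable_in_verts by fastforce
  next
    case (Suc n)
    have "x \<noteq> y" using Suc.prems reachable_in_verts(1) by fastforce
    then obtain z where z: "x \<rightarrow>\<^bsub>G\<^esub> z" "graph_dist G z y = n"
      using Suc.prems by (metis graph_dist_stepE nat.inject)
    have zx: "z \<rightarrow>\<^bsub>G\<^esub> x" using z(1) by (rule graph_symmetric)
    then have zy: "z \<rightarrow>\<^sup>* y" using Suc.prems(1) adj_reachable_trans by blast
    then have "graph_dist G y x \<le> graph_dist G y z + graph_dist G z x"
      using zx by (intro graph_dist_triangle) (auto intro: symmetric_reachable')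
    with graph_dist_adj_le[OF zx] Suc.hyps[OF zy z(2)] show ?case by simp
  qed
  then show ?thesis
    using assms symmetric_reachable' by (metis le_antisym)
qed

section \<open>Cycles in blocks\<close>

context graph
begin

lemma graph_induce_subgraph: "S \<subseteq> verts G \<Longrightarrow> graph (G \<restriction> S)"
  by (meson digraph.graphI digraph_subgraph induced_graph_imp_symmetric induced_imp_subgraph
      induced_induce sym_arcs)

lemma induce_subgraph_adj_iff: "x \<rightarrow>\<^bsub>G \<restriction> S\<^esub> y \<longleftrightarrow> x \<rightarrow>\<^bsub>G\<^esub> y \<and> x \<in> S \<and> y \<in> S"
  by (auto simp: arcs_ends_conv)

text \<open>By symmetry of the arcs, reaching a common hub \<open>h\<close> from everywhere already
  links any two vertices through \<open>h\<close>.\<close>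

lemma connected_induce_subgraphI:
  assumes "S \<subseteq> verts G" "h \<in> S" "\<And>x. x \<in> S \<Longrightarrow> x \<rightarrow>\<^sup>*\<^bsub>G \<restriction> S\<^esub> h"
  shows "connected (G \<restriction> S)"
proof -
  interpret S: graph "G \<restriction> S" using assms(1) by (rule graph_induce_subgraph)
  have "x \<rightarrow>\<^sup>*\<^bsub>mk_symmetric (G \<restriction> S)\<^esub> y" if "x \<in> S" "y \<in> S" for x y
    using S.reachable_trans[OF assms(3) S.symmetric_reachable'[OF assms(3)]] that
    by (intro S.reachable_mk_symmetricI)
  then show ?thesis
    using assms(2) by (auto simp: connected_def strongly_connected_def)
qed

lemma vwalk_induce_subgraph:
  assumes "vwalk p G" "set p \<subseteq> S"
  shows "vwalk p (G \<restriction> S)"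
proof -
  have "a \<in> S \<and> b \<in> S" if "(a, b) \<in> set (vwalk_arcs p)" for a b
    using that assms(2) by (auto elim: in_set_vwalk_arcsE)
  with assms show ?thesis by (auto simp: vwalk_def induce_subgraph_adj_iff)
qed

lemma vwalk_reachable_last:
  assumes "vwalk p G" "set p \<subseteq> S" "x \<in> set p"
  shows "x \<rightarrow>\<^sup>*\<^bsub>G \<restriction> S\<^esub> last p"
proof -
  interpret S: wf_digraph "G \<restriction> S" ..
  obtain p1 p2 where p: "p = p1 @ x # p2" using assms(3) by (meson split_list)
  then have "vwalk (x # p2) (G \<restriction> S)"
    using vwalk_induce_subgraph[OF assms(1,2)] vwalkI_append_r by blast
  then show ?thesis
    unfolding S.reachable_vwalk_conv using p by force
qed

lemma vwalk_reachable_hd: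
  assumes "vwalk p G" "set p \<subseteq> S" "x \<in> set p"
  shows "x \<rightarrow>\<^sup>*\<^bsub>G \<restriction> S\<^esub> hd p"
proof -
  have "vwalk (rev p) G" "p \<noteq> []"
    using vwalk_rev_ex[OF sym_arcs assms(1)] assms(3) by auto
  then show ?thesis
    using vwalk_reachable_last[of "rev p" S x] assms(2,3) by (simp add: last_rev)
qed

text \<open>The vertex \<open>w\<close> closes the path \<open>p\<close> to a cycle; chords in the
  induced subgraph do no harm. Whichever vertex is deleted, the rest is connected: the hub is
  \<open>hd p\<close> or \<open>last p\<close> if \<open>w\<close> goes, and \<open>w\<close>
  otherwise.\<close>

lemma two_connected_cycle:
  assumes p: "vpath p G" "hd p \<noteq> last p" and w: "w \<notin> set p" "w \<rightarrow>\<^bsub>G\<^esub> hd p" "w \<rightarrow>\<^bsub>G\<^esub> last p"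
  shows "two_connected (G \<restriction> insert w (set p))"
proof -
  let ?S = "insert w (set p)"
  have pw: "vwalk p G" "distinct p" and ne: "p \<noteq> []" using p by auto
  have S: "?S \<subseteq> verts G" using pw(1) w(2) adj_in_verts by auto
  have hp: "hd p \<in> set p" "last p \<in> set p" using ne by auto
  have "card {w, hd p, last p} \<le> card ?S"
    using hp by (intro card_mono) auto
  moreover have "card {w, hd p, last p} = 3"
    using hp w(1) p(2) by (auto simp: card_insert_if)
  ultimately have card: "3 \<le> card ?S" by simp
  have to_w: "x \<rightarrow>\<^sup>*\<^bsub>G \<restriction> T\<^esub> w" if "x \<rightarrow>\<^sup>*\<^bsub>G \<restriction> T\<^esub> y" "y = hd p \<or> y = last p" "w \<in> T" for x y T
  proof -
    interpret T: wf_digraph "G \<restriction> T" ..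
    have "y \<in> T" using that(1) T.reachable_in_verts(2) by force
    then have "y \<rightarrow>\<^bsub>G \<restriction> T\<^esub> w"
      using that(2,3) w graph_symmetric by (auto simp: induce_subgraph_adj_iff)
    with that(1) show ?thesis by (rule T.reachable_adj_trans)
  qed
  have del: "pre_digraph.del_vert (G \<restriction> ?S) v = G \<restriction> (?S - {v})" for v
    by (auto simp: pre_digraph.del_vert_def induce_subgraph_def)
  have "connected (G \<restriction> ?S)"
  proof (rule connected_induce_subgraphI[OF S])
    interpret S: wf_digraph "G \<restriction> ?S" ..
    fix x assume "x \<in> ?S"
    then show "x \<rightarrow>\<^sup>*\<^bsub>G \<restriction> ?S\<^esub> w"
      using to_w vwalk_reachable_hd[OF pw(1), of ?S x] by auto
  qed simp
  moreover have "connected (G \<restriction> (?S - {v}))" if "v \<in> ?S" for v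
  proof (cases "v = w")
    case True
    then have eq: "?S - {v} = set p" using w(1) by auto
    show ?thesis unfolding eq
      using S hp vwalk_reachable_hd[OF pw(1)] by (intro connected_induce_subgraphI) auto
  next
    case False
    let ?T = "?S - {v}"
    interpret T: wf_digraph "G \<restriction> ?T" ..
    \<comment> \<open>Deleting \<open>v\<close> cuts \<open>p\<close> into two pieces. The first
      keeps the head of \<open>p\<close>, the second its last vertex, and both of these are
      neighbours of \<open>w\<close>.\<close>
    from False that obtain p1 p2 where p12: "p = p1 @ v # p2" by (metis insertE split_list)
    show ?thesis
    proof (rule connected_induce_subgraphI)
      fix x assume x: "x \<in> ?T"
      consider "x = w" | "x \<in> set p1" | "x \<in> set p2" using x p12 by auto
      then show "x \<rightarrow>\<^sup>*\<^bsub>G \<restriction> ?T\<^esub> w"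
      proof cases
        case 1
        then show ?thesis using False by auto
      next
        case 2
        then have "vwalk p1 G" "hd p1 = hd p"
          using p12 pw(1) vwalkI_append_l[of p1 "v # p2"] by (force, cases p1, auto)
        then have "x \<rightarrow>\<^sup>*\<^bsub>G \<restriction> ?T\<^esub> hd p"
          using vwalk_reachable_hd[of p1 ?T x] 2 p12 pw(2) by auto
        then show ?thesis using to_w False by auto
      next
        case 3
        then have "vwalk p2 G" "last p2 = last p"
          using p12 pw(1) vwalkI_append_r[of p2 "p1 @ [v]"] by (force, cases p2, auto)
        then have "x \<rightarrow>\<^sup>*\<^bsub>G \<restriction> ?T\<^esub> last p"
          using vwalk_reachable_last[of p2 ?T x] 3 p12 pw(2) by auto
        then show ?thesis using to_w False by auto
      qed
    qed (use S False in auto)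
  qed
  ultimately show ?thesis
    unfolding two_connected_def using graph_induce_subgraph[OF S] card by (auto simp: del)
qed

text \<open>Among the subgraphs of \<open>G\<close> that contain \<open>H\<close> and satisfy
  \<open>P\<close>, choose one with the most vertices and arcs together; finiteness of
  \<open>G\<close> bounds this count.\<close>

lemma max_subgraph_extend:
  assumes "subgraph H G" "P H"
  obtains H' where "subgraph H H'" "max_subgraph P H'"
proof -
  let ?Q = "\<lambda>K. subgraph H K \<and> subgraph K G \<and> P K"
  let ?f = "\<lambda>K. card (verts K) + card (arcs K)"
  have card_le: "card (verts K) \<le> card (verts L)" "card (arcs K) \<le> card (arcs L)"
    if "subgraph K L" "subgraph L G" for K L
    using that fin_digraph_subgraph[OF that(2)]
    by (auto intro!: card_mono simp: fin_digraph.finite_verts fin_digraph.finite_arcs)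
  have "?Q H" using assms by (auto intro: wf_digraph.subgraph_refl)
  moreover have "\<forall>K. ?Q K \<longrightarrow> ?f K < Suc (?f G)"
    using card_le[of _ G] subgraph_refl by (simp add: add_mono less_Suc_eq_le)
  ultimately have "\<exists>M. ?Q M \<and> (\<forall>K. ?Q K \<longrightarrow> ?f K \<le> ?f M)"
    by (rule ex_has_greatest_nat)
  then obtain M where M: "?Q M" "\<And>K. ?Q K \<Longrightarrow> ?f K \<le> ?f M" by blast
  have "K = M" if K: "subgraph M K" "subgraph K G" "P K" for K
  proof -
    have "?f K \<le> ?f M" using K M subgraph_trans by blast
    with card_le[OF K(1,2)]
    have "card (verts K) = card (verts M)" "card (arcs K) = card (arcs M)" by simp_all
    moreover interpret K: fin_digraph K using K(2) by (rule fin_digraph_subgraph)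
    \<comment> \<open>Inclusion with equal finite cardinalities gives equal vertex and arc sets;
      \<open>compatible\<close> supplies equal \<open>tail\<close> and \<open>head\<close>.\<close>
    have "verts M \<subseteq> verts K" "arcs M \<subseteq> arcs K" "compatible K M" using K(1) by auto
    ultimately show ?thesis
      by (intro pre_digraph.equality)
        (auto simp: compatible_def dest: card_subset_eq[OF K.finite_verts] card_subset_eq[OF K.finite_arcs])
  qed
  with M(1) have "max_subgraph P M" by (auto simp: max_subgraph_def)
  with M(1) that show thesis by blast
qed

end

lemma block_graph_neighbours_adj:
  assumes "block_graph G" "w \<rightarrow>\<^bsub>G\<^esub> a" "w \<rightarrow>\<^bsub>G\<^esub> c" "a \<noteq> c"
    and ac: "a \<rightarrow>\<^sup>*\<^bsub>G \<restriction> (verts G - {w})\<^esub> c"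
  shows "a \<rightarrow>\<^bsub>G\<^esub> c"
proof -
  interpret graph G using assms(1) by (simp add: block_graph_def)
  let ?D = "G \<restriction> (verts G - {w})"
  interpret D: wf_digraph ?D ..
  obtain p where p: "vpath p ?D" "hd p = a" "last p = c"
    using ac unfolding D.reachable_vpath_conv by blast
  have wp: "w \<notin> set p" using p(1) by (auto simp: vpath_def vwalk_def)
  have "arcs_ends ?D \<subseteq> arcs_ends G" by (auto simp: arcs_ends_conv)
  then have pG: "vpath p G" using p(1) by (auto simp: vpath_def vwalk_def)
  have ends: "a \<in> set p" "c \<in> set p" using p by (auto simp: vpath_def vwalk_def)
  let ?H = "G \<restriction> insert w (set p)"
  have "two_connected ?H"
    using two_connected_cycle[OF pG _ wp] p assms by simp
  moreover have "subgraph ?H G"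
    using pG assms(2) adj_in_verts
    by (intro induced_imp_subgraph induced_induce) (auto simp: vpath_def vwalk_def)
  ultimately obtain M where M: "subgraph ?H M" "max_subgraph two_connected M"
    using max_subgraph_extend by blast
  then have "K\<^bsub>card (verts M)\<^esub> M"
    using assms(1) by (auto simp: block_graph_def graph_block_def)
  moreover have "a \<in> verts M" "c \<in> verts M"
    using subgraph_imp_subverts[OF M(1)] ends by auto
  ultimately have "a \<rightarrow>\<^bsub>M\<^esub> c" using \<open>a \<noteq> c\<close> by (auto simp: complete_digraph_def)
  then show ?thesis
    using M(2) arcs_ends_mono by (auto simp: max_subgraph_def)
qed

section \<open>The four-point condition\<close>

locale connected_block_graph = graph +
  assumes block_graph: "block_graph G"
begin

abbreviation d :: "'a \<Rightarrow> 'a \<Rightarrow> nat" where "d \<equiv> graph_dist G"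

lemma reach: "u \<in> verts G \<Longrightarrow> v \<in> verts G \<Longrightarrow> u \<rightarrow>\<^sup>* v"
  using block_graph symmetric_connected_imp_strongly_connected[OF sym_arcs]
  by (auto simp: block_graph_def)

lemma d_sym: "u \<in> verts G \<Longrightarrow> v \<in> verts G \<Longrightarrow> d u v = d v u"
  using graph_dist_sym reach by blast

lemma d_triangle:
  "u \<in> verts G \<Longrightarrow> v \<in> verts G \<Longrightarrow> w \<in> verts G \<Longrightarrow> d u w \<le> d u v + d v w"
  using graph_dist_triangle reach by blast

text \<open>The strict inequality says that no geodesic from \<open>u\<close> to \<open>x\<close>
  meets \<open>w\<close>. It passes on to the next vertex \<open>y\<close> of a geodesic:
  \<open>d y x\<close> is smaller than \<open>d u x\<close> by one, while \<open>d y w\<close> is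
  smaller than \<open>d u w\<close> by at most one. It also excludes \<open>u = w\<close>, where it
  would read \<open>d w x < d w x\<close>.\<close>

lemma reachable_avoiding:
  assumes "u \<in> verts G" "x \<in> verts G" "w \<in> verts G" "d u x < d u w + d w x"
  shows "u \<rightarrow>\<^sup>*\<^bsub>G \<restriction> (verts G - {w})\<^esub> x"
  using assms
proof (induct "d u x" arbitrary: u)
  case 0
  then have "u = x" "u \<noteq> w" using graph_dist_eq_0D reach by auto
  then show ?case using 0 by (auto simp: reachable_def)
next
  case (Suc n)
  interpret D: wf_digraph "G \<restriction> (verts G - {w})" ..
  have "u \<noteq> x" "u \<noteq> w" using Suc.hyps(2) Suc.prems by auto
  with Suc.prems obtain y where y: "u \<rightarrow>\<^bsub>G\<^esub> y" "Suc (d y x) = d u x"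
    using reach by (metis graph_dist_stepE)
  have yv: "y \<in> verts G" using y(1) adj_in_verts by blast
  have less: "d y x < d y w + d w x"
    using Suc.prems d_triangle[of u y w] yv y(2) graph_dist_adj_le[OF y(1)] by linarith
  then have "y \<noteq> w" using yv by auto
  with y(1) \<open>u \<noteq> w\<close> Suc.prems yv have "u \<rightarrow>\<^bsub>G \<restriction> (verts G - {w})\<^esub> y"
    by (simp add: induce_subgraph_adj_iff)
  moreover have "y \<rightarrow>\<^sup>*\<^bsub>G \<restriction> (verts G - {w})\<^esub> x"
    using y(2) Suc.hyps(2) by (intro Suc.hyps(1) yv Suc.prems less) simp
  ultimately show ?case by (rule D.adj_reachable_trans)
qed

lemma between_cases:
  assumes V: "u \<in> verts G" "v \<in> verts G" "w \<in> verts G" "x \<in> verts G"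
    and w: "d u w + d w v = d u v"
  shows "d u w + d w x = d u x \<or> d v w + d w x = d v x"
proof (rule ccontr)
  assume neg: "\<not> ?thesis"
  let ?D = "G \<restriction> (verts G - {w})"
  interpret D: graph ?D by (rule graph_induce_subgraph) auto
  have less: "d u x < d u w + d w x" "d v x < d v w + d w x"
    using neg d_triangle[of u w x] d_triangle[of v w x] V by linarith+
  then have "w \<noteq> u" "w \<noteq> v" using V by auto
  \<comment> \<open>Let \<open>a\<close> and \<open>c\<close> be the neighbours of \<open>w\<close>
    on geodesics towards \<open>u\<close> and \<open>v\<close>. They turn out to be joined by a
    detour through \<open>x\<close> that avoids \<open>w\<close>, so they are equal or adjacent, and
    bypassing \<open>w\<close> shortens the distance from \<open>u\<close> to \<open>v\<close> by at
    least one.\<close>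
  then obtain a c where a: "w \<rightarrow>\<^bsub>G\<^esub> a" "Suc (d a u) = d w u" and c: "w \<rightarrow>\<^bsub>G\<^esub> c" "Suc (d c v) = d w v"
    using V reach by (metis graph_dist_stepE)
  have V': "a \<in> verts G" "c \<in> verts G" using a c adj_in_verts by blast+
  note V = V V'
  have "a \<rightarrow>\<^sup>*\<^bsub>?D\<^esub> u" "c \<rightarrow>\<^sup>*\<^bsub>?D\<^esub> v" "u \<rightarrow>\<^sup>*\<^bsub>?D\<^esub> x" "v \<rightarrow>\<^sup>*\<^bsub>?D\<^esub> x"
    using V a(2) c(2) less by (auto intro!: reachable_avoiding)
  then have ac: "a \<rightarrow>\<^sup>*\<^bsub>?D\<^esub> c"
    using D.symmetric_reachable' D.reachable_trans by meson
  have "d a c \<le> 1"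
  proof (cases "a = c")
    case False
    then show ?thesis
      using block_graph_neighbours_adj[OF block_graph a(1) c(1) _ ac] graph_dist_adj_le by blast
  qed (use V in simp)
  moreover have "d u v \<le> d u a + d a c + d c v"
    using d_triangle[of u a v] d_triangle[of a c v] V by linarith
  ultimately show False
    using w a(2) c(2) d_sym[of a u] d_sym[of w u] V by linarith
qed

text \<open>Induction along a geodesic from \<open>u\<close> to \<open>v\<close>: passing from the
  next vertex \<open>t\<close> back to \<open>u\<close> raises the left side by one, so the right
  side has to gain one as well.\<close>

lemma four_point:
  assumes "u \<in> verts G" "v \<in> verts G" "x \<in> verts G" "y \<in> verts G"
  shows "d u v + d x y \<le> max (d u x + d v y) (d u y + d v x)"
  using assms
proof (induct "d u v" arbitrary: u)
  case 0
  then have "u = v" using graph_dist_eq_0D reach by auto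
  then show ?case using d_triangle[of x u y] d_sym[of x u] 0 by auto
next
  case (Suc n)
  have "u \<noteq> v" using Suc.hyps(2) Suc.prems by auto
  then obtain t where t: "u \<rightarrow>\<^bsub>G\<^esub> t" "Suc (d t v) = d u v"
    using Suc.prems reach by (metis graph_dist_stepE)
  have tv: "t \<in> verts G" using t(1) adj_in_verts by blast
  note V = Suc.prems tv
  have "u \<noteq> t" using t(2) by auto
  then have "d u t \<noteq> 0" using graph_dist_eq_0D[of u t] reach V by auto
  with graph_dist_adj_le[OF t(1)] have ut: "d u t = 1" by simp
  have IH: "d t v + d x y \<le> max (d t x + d v y) (d t y + d v x)"
    using Suc.hyps V t(2) by auto
  \<comment> \<open>Since \<open>t\<close> is between \<open>u\<close> and \<open>v\<close>, each
    \<open>z\<close> either is one farther from \<open>u\<close> than from \<open>t\<close> or has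
    \<open>t\<close> between \<open>v\<close> and itself.\<close>
  have btw: "1 + d t z = d u z \<or> d v t + d t z = d v z" if "z \<in> verts G" for z
    using between_cases[of u v t z] V that ut t(2) by auto
  have near: "d u z \<le> 1 + d t z" "d t z \<le> 1 + d u z" if "z \<in> verts G" for z
    using d_triangle[of u t z] d_triangle[of t u z] d_sym[of u t] ut V that by auto
  \<comment> \<open>If \<open>u\<close> were between \<open>x\<close> and \<open>y\<close>, it would be between \<open>t\<close> and one of them.\<close>
  have eq: "d x y < d u x + d u y" if "d u x = d t x" "d u y = d t y"
  proof (rule ccontr)
    assume "\<not> ?thesis"
    then have "d x u + d u y = d x y"
      using d_triangle[of x u y] d_sym[of x u] V by linarith
    then have "d x u + d u t = d x t \<or> d y u + d u t = d y t"
      using between_cases[of x y u t] V by blast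
    then show False
      using that ut d_sym[of x u] d_sym[of y u] d_sym[of x t] d_sym[of y t] V by auto
  qed
  have tri: "d x y \<le> d u x + d u y" "d x y \<le> d t x + d t y"
    using d_triangle[of x u y] d_triangle[of x t y] d_sym[of x u] d_sym[of x t] V by auto
  have vt: "Suc (d v t) = d u v" using t(2) d_sym[of v t] V by simp
  show ?case
  proof (cases "d u x = d t x \<and> d u y = d t y")
    case True
    \<comment> \<open>Here \<open>t\<close> is between \<open>v\<close> and \<open>x\<close>, and
      the strictness in \<open>eq\<close> provides the missing unit.\<close>
    with btw[of x] eq vt V have "d v x = d v t + d t x" "d x y < d t x + d u y" by auto
    then show ?thesis using vt by linarith
  next
    case False
    \<comment> \<open>If both \<open>x\<close> and \<open>y\<close> are one farther from
      \<open>u\<close> than from \<open>t\<close>, the induction hypothesis gains one. If exactly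
      one is, \<open>t\<close> is between \<open>v\<close> and the other, and the triangle
      inequality through \<open>t\<close> suffices. If neither is, one of them is strictly closer to
      \<open>u\<close>, and the triangle inequality through \<open>u\<close> yields the
      unit.\<close>
    with IH btw[OF V(3)] btw[OF V(4)] near[OF V(3)] near[OF V(4)] tri vt t(2)
    show ?thesis by linarith
  qed
qed

end

section \<open>Hangability\<close>

theorem theorem1:
  fixes G :: "('a, 'b) pre_digraph"
  assumes "block_graph G"
  shows "hangable G"
proof -
  interpret graph G using assms by (simp add: block_graph_def)
  interpret connected_block_graph G by unfold_locales (rule assms)
  have ecc: "d a b \<le> eccentricity G a" if "b \<in> verts G" for a b
    unfolding eccentricity_def using that by (intro Max_ge) auto
  have ecc_le: "eccentricity G a \<le> graph_diameter G" if "a \<in> verts G" for a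
    unfolding graph_diameter_def using that by (intro Max_ge) auto
  have "u \<in> graph_periphery G" if v: "v \<in> verts G" and u: "u \<in> vertex_periphery G v" for u v
  proof -
    have uV: "u \<in> verts G" and far: "d v u = eccentricity G v"
      using u by (auto simp: vertex_periphery_def)
    have "graph_diameter G \<in> eccentricity G ` verts G"
      unfolding graph_diameter_def using v by (intro Max_in) auto
    then obtain x where x: "x \<in> verts G" "graph_diameter G = eccentricity G x" by blast
    have "eccentricity G x \<in> d x ` verts G"
      unfolding eccentricity_def using v by (intro Max_in) auto
    then obtain y where y: "y \<in> verts G" "graph_diameter G = d x y" using x by auto
    \<comment> \<open>As \<open>u\<close> is farthest from \<open>v\<close>, both
      \<open>d v x\<close> and \<open>d v y\<close> are at most \<open>d u v\<close>, which
      therefore cancels in the four-point condition.\<close>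
    have "d x y \<le> max (d u x) (d u y)"
      using four_point[OF uV v x(1) y(1)] ecc[OF x(1), of v] ecc[OF y(1), of v] far
        d_sym[OF uV v] by linarith
    then have "graph_diameter G \<le> eccentricity G u"
      using y ecc[of x u] ecc[of y u] x(1) by linarith
    with ecc_le[OF uV] uV show ?thesis by (simp add: graph_periphery_def)
  qed
  then show ?thesis
    using assms by (auto simp: hangable_def block_graph_def)
qed

end
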